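(* Let $\alpha$ be an irrational number whose ordinary (regular) continued fraction has unbounded partial quotients. Then $\{\mathcal M_+(\alpha,\beta):\beta\in\mathbf R\}=[0,\mathcal M_+(\alpha)]$, where $\mathcal M_+(\alpha)=\sup_{\beta\in\mathbf R}\mathcal M_+(\alpha,\beta)$.
   Context: $\|x\|$ is the distance from $x$ to the nearest integer and $\mathcal M_+(\alpha,\beta)=\liminf_{q\to\infty}q\|q\alpha-\beta\|$, $q$ running over positive integers. *)

theory Defs
  imports "HOL-Analysis.Analysis"
begin

definition dist_nearest_int :: "real \<Rightarrow> real"
  where "dist_nearest_int x = infdist x \<int>"

(* The real-valued sequence is embedded into ereal because the library's liminf lives in
   complete lattices; the index q = 0 does not influence the limit inferior. *)
definition M_plus :: "real \<Rightarrow> real \<Rightarrow> ereal"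
  where "M_plus \<alpha> \<beta> = liminf (\<lambda>q::nat. ereal (real q * dist_nearest_int (real q * \<alpha> - \<beta>)))"

definition M_plus_sup :: "real \<Rightarrow> ereal"
  where "M_plus_sup \<alpha> = (SUP \<beta>::real. M_plus \<alpha> \<beta>)"

(* Complete quotients of the regular continued fraction. The division never degenerates when
   the argument is irrational; rational numbers, whose expansion terminates, get 1 / 0 = 0 from
   some index on. *)
fun complete_quotient :: "real \<Rightarrow> nat \<Rightarrow> real"
  where
    "complete_quotient \<alpha> 0 = \<alpha>"
  | "complete_quotient \<alpha> (Suc n) = 1 / frac (complete_quotient \<alpha> n)"

definition partial_quotient :: "real \<Rightarrow> nat \<Rightarrow> int"
  where "partial_quotient \<alpha> n = \<lfloor>complete_quotient \<alpha> n\<rfloor>"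

end

theory Submission
  imports Defs "HOL-Number_Theory.Cong" "HOL-Complex_Analysis.Great_Picard"
begin

text \<open>Unbounded partial quotients provide coprime \<open>p, q\<close> with \<open>q \<bar>q \<alpha> - p\<bar>\<close> arbitrarily small. Moving \<open>\<beta>\<close> by
  multiples of \<open>q \<alpha> - p\<close> for such \<open>q\<close> leaves \<open>M\<^sub>+(\<alpha>, \<beta>)\<close> unchanged but pushes the minimum of the products
  \<open>n \<parallel>n \<alpha> - \<beta>\<parallel>\<close> over large \<open>n\<close> down to \<open>0\<close> in small steps, so that it can be stopped just above any
  prescribed \<open>c < M\<^sub>+(\<alpha>, \<beta>)\<close>. Repeating this at ever larger \<open>q\<close> makes the translates converge to a point
  with \<open>M\<^sub>+ = c\<close>. To attain the supremum, translates of points with values tending to it are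
  spliced together along good denominators \<open>q\<close> for which their residues \<open>q \<beta>\<close> modulo 1 are close.\<close>

section \<open>Distance to the nearest integer\<close>

lemma dist_nearest_int_le: "dist_nearest_int x \<le> \<bar>x - of_int m\<bar>"
  unfolding dist_nearest_int_def by (metis Ints_of_int dist_real_def infdist_le)

lemma dist_nearest_int_nonneg: "0 \<le> dist_nearest_int x"
  by (simp add: dist_nearest_int_def infdist_nonneg)

lemma dist_nearest_int_attained: obtains m :: int where "dist_nearest_int x = \<bar>x - of_int m\<bar>"
proof -
  have "closed (\<int>::real set)" "(\<int>::real set) \<noteq> {}"
    by (auto intro: closed_Ints)
  then obtain y :: real where "y \<in> \<int>" "infdist x \<int> = dist x y"
    by (rule infdist_attains_inf)
  then show ?thesis
    using that by (auto simp: dist_nearest_int_def dist_real_def elim!: Ints_cases)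
qed

lemma dist_nearest_int_lipschitz: "\<bar>dist_nearest_int x - dist_nearest_int y\<bar> \<le> \<bar>x - y\<bar>"
  unfolding dist_nearest_int_def by (metis dist_real_def infdist_triangle_abs)

lemma dist_nearest_int_diff_of_int: "dist_nearest_int (x - of_int m) = dist_nearest_int x"
proof (rule antisym)
  obtain k where k: "dist_nearest_int x = \<bar>x - of_int k\<bar>"
    by (rule dist_nearest_int_attained)
  show "dist_nearest_int (x - of_int m) \<le> dist_nearest_int x"
    using dist_nearest_int_le[of "x - of_int m" "k - m"] k by simp
  obtain l where l: "dist_nearest_int (x - of_int m) = \<bar>x - of_int m - of_int l\<bar>"
    by (rule dist_nearest_int_attained)
  show "dist_nearest_int x \<le> dist_nearest_int (x - of_int m)"
    using dist_nearest_int_le[of x "m + l"] l by (simp add: diff_diff_eq)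
qed

section \<open>The products under the limit inferior and their behaviour under translation\<close>

definition inhom_product :: "real \<Rightarrow> real \<Rightarrow> nat \<Rightarrow> real"
  where "inhom_product \<alpha> \<beta> q = real q * dist_nearest_int (real q * \<alpha> - \<beta>)"

lemma inhom_product_nonneg: "0 \<le> inhom_product \<alpha> \<beta> q"
  by (simp add: inhom_product_def dist_nearest_int_nonneg)

lemma inhom_product_le: "inhom_product \<alpha> \<beta> q \<le> real q * \<bar>real q * \<alpha> - of_int m - \<beta>\<bar>"
  using dist_nearest_int_le[of "real q * \<alpha> - \<beta>" m]
  by (auto simp: inhom_product_def algebra_simps intro!: mult_left_mono)

lemma inhom_product_lipschitz:
  "\<bar>inhom_product \<alpha> \<beta> q - inhom_product \<alpha> \<gamma> q\<bar> \<le> real q * \<bar>\<beta> - \<gamma>\<bar>"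
proof -
  have "\<bar>inhom_product \<alpha> \<beta> q - inhom_product \<alpha> \<gamma> q\<bar> =
      real q * \<bar>dist_nearest_int (real q * \<alpha> - \<beta>) - dist_nearest_int (real q * \<alpha> - \<gamma>)\<bar>"
    by (simp add: inhom_product_def abs_mult flip: right_diff_distrib)
  also have "\<dots> \<le> real q * \<bar>(real q * \<alpha> - \<beta>) - (real q * \<alpha> - \<gamma>)\<bar>"
    by (intro mult_left_mono dist_nearest_int_lipschitz) auto
  finally show ?thesis by (simp add: abs_minus_commute)
qed

text \<open>The two arguments of the distance differ by an integer, so only the factor in front
  grows. Lower bounds for \<beta> therefore pass to its translates by nonnegative multiples of
  \<alpha>, with the index moved by \<open>N\<close>.\<close>

lemma inhom_product_shift:
  "inhom_product \<alpha> \<beta> q \<le> inhom_product \<alpha> (\<beta> + real N * \<alpha> - of_int m) (q + N)"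
proof -
  have "real (q + N) * \<alpha> - (\<beta> + real N * \<alpha> - of_int m) = (real q * \<alpha> - \<beta>) - of_int (- m)"
    by (simp add: algebra_simps)
  then have "inhom_product \<alpha> (\<beta> + real N * \<alpha> - of_int m) (q + N)
      = real (q + N) * dist_nearest_int (real q * \<alpha> - \<beta>)"
    by (simp only: inhom_product_def dist_nearest_int_diff_of_int)
  moreover have "inhom_product \<alpha> \<beta> q \<le> real (q + N) * dist_nearest_int (real q * \<alpha> - \<beta>)"
    unfolding inhom_product_def by (intro mult_right_mono dist_nearest_int_nonneg) auto
  ultimately show ?thesis by simp
qed

lemma M_plus_eq: "M_plus \<alpha> \<beta> = liminf (\<lambda>q. ereal (inhom_product \<alpha> \<beta> q))"
  by (simp add: M_plus_def inhom_product_def)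

lemma M_plus_geI:
  assumes "\<And>e. 0 < e \<Longrightarrow> \<exists>Q. \<forall>q\<ge>Q. c - e \<le> inhom_product \<alpha> \<beta> q"
  shows "ereal c \<le> M_plus \<alpha> \<beta>"
  unfolding M_plus_eq le_Liminf_iff
proof safe
  fix y assume y: "y < ereal c"
  then obtain r where r: "y < ereal r" "r < c"
    by (meson ereal_dense2 less_ereal.simps(1))
  obtain Q where "\<forall>q\<ge>Q. c - (c - r) \<le> inhom_product \<alpha> \<beta> q"
    using assms[of "c - r"] r by auto
  then show "\<forall>\<^sub>F q in sequentially. y < ereal (inhom_product \<alpha> \<beta> q)"
    unfolding eventually_sequentially using r(1)
    by (metis diff_diff_eq2 add_diff_cancel_left' ereal_less_eq(3) less_le_trans)
qed

lemma M_plus_gtD: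
  assumes "ereal c < M_plus \<alpha> \<beta>"
  obtains Q where "\<And>q. Q \<le> q \<Longrightarrow> c < inhom_product \<alpha> \<beta> q"
  using less_LiminfD[OF assms[unfolded M_plus_eq]] unfolding eventually_sequentially by auto

lemma M_plus_leI:
  assumes "\<And>e Q. 0 < e \<Longrightarrow> \<exists>q\<ge>Q. inhom_product \<alpha> \<beta> q \<le> c + e"
  shows "M_plus \<alpha> \<beta> \<le> ereal c"
proof (rule ccontr)
  assume "\<not> ?thesis"
  then obtain d where d: "ereal c < ereal d" "ereal d < M_plus \<alpha> \<beta>"
    using ereal_dense2 by (metis not_le)
  obtain Q where "\<And>q. Q \<le> q \<Longrightarrow> d < inhom_product \<alpha> \<beta> q"
    using M_plus_gtD d(2) by blast
  then show False
    using assms[of "d - c" Q] d(1) by force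
qed

lemma M_plus_nonneg: "0 \<le> M_plus \<alpha> \<beta>"
  using M_plus_geI[of 0 \<alpha> \<beta>] inhom_product_nonneg[of \<alpha> \<beta>]
  by (metis add_0 diff_add_cancel diff_le_eq less_eq_real_def order_trans zero_ereal_def)

section \<open>From large partial quotients to good rational approximations\<close>

lemma complete_quotient_notin_Rats:
  assumes "\<alpha> \<notin> \<rat>"
  shows "complete_quotient \<alpha> n \<notin> \<rat>"
proof (induction n)
  case (Suc n)
  show ?case
  proof
    assume "complete_quotient \<alpha> (Suc n) \<in> \<rat>"
    then have "1 / complete_quotient \<alpha> (Suc n) \<in> \<rat>"
      by (intro Rats_divide) auto
    then have "frac (complete_quotient \<alpha> n) \<in> \<rat>"
      by simp
    then have "frac (complete_quotient \<alpha> n) + of_int \<lfloor>complete_quotient \<alpha> n\<rfloor> \<in> \<rat>"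
      by (intro Rats_add) auto
    with Suc show False by (simp add: frac_def)
  qed
qed (use assms in auto)

lemma complete_quotient_eq:
  "complete_quotient \<alpha> n =
    of_int \<lfloor>complete_quotient \<alpha> n\<rfloor> + 1 / complete_quotient \<alpha> (Suc n)"
  by (simp add: frac_def)

lemma complete_quotient_gt_1:
  assumes "\<alpha> \<notin> \<rat>"
  shows "1 < complete_quotient \<alpha> (Suc n)"
proof -
  have "frac (complete_quotient \<alpha> n) \<noteq> 0"
    using complete_quotient_notin_Rats[OF assms, of n] Ints_subset_Rats by auto
  then have "0 < frac (complete_quotient \<alpha> n)" "frac (complete_quotient \<alpha> n) < 1"
    using frac_ge_0 frac_lt_1 by (auto simp: less_le)
  then show ?thesis by simp
qed

text \<open>Here \<open>p / q\<close> and \<open>p' / q'\<close> are consecutive convergents.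
  Substituting \<open>x = a + 1 / y\<close> for the complete quotient multiplies their matrix by one
  of determinant -1, which preserves the absolute determinant 1.\<close>

lemma complete_quotient_moebius:
  assumes "\<alpha> \<notin> \<rat>"
  shows "\<exists>(p::int) (q::int) (p'::int) (q'::int). 0 < q \<and> 0 \<le> q' \<and> \<bar>p * q' - p' * q\<bar> = 1 \<and>
    \<alpha> * (of_int q * complete_quotient \<alpha> (Suc n) + of_int q') =
      of_int p * complete_quotient \<alpha> (Suc n) + of_int p'"
proof (induction n)
  case 0
  define x where "x = complete_quotient \<alpha> (Suc 0)"
  have x: "1 < x" "\<alpha> = of_int \<lfloor>\<alpha>\<rfloor> + 1 / x"
    unfolding x_def using complete_quotient_gt_1[OF assms, of 0] complete_quotient_eq[of \<alpha> 0]
    by auto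
  have eq: "\<alpha> * x = of_int \<lfloor>\<alpha>\<rfloor> * x + 1"
    by (subst x(2)) (use x(1) in \<open>simp add: field_simps\<close>)
  \<comment> \<open>The recursion starts from the convergents
    \<open>\<lfloor>\<alpha>\<rfloor> / 1\<close> and the formal \<open>1 / 0\<close>.\<close>
  show ?case
    unfolding x_def[symmetric]
    by (rule exI[of _ "\<lfloor>\<alpha>\<rfloor>"], rule exI[of _ "1::int"],
      rule exI[of _ "1::int"], rule exI[of _ "0::int"]) (simp add: eq)
next
  case (Suc n)
  define x where "x = complete_quotient \<alpha> (Suc n)"
  define y where "y = complete_quotient \<alpha> (Suc (Suc n))"
  define a where "a = \<lfloor>x\<rfloor>"
  have y: "1 < y" and x: "1 < x" "x = of_int a + 1 / y"
    unfolding x_def y_def a_def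
    by (rule complete_quotient_gt_1[OF assms] complete_quotient_eq)+
  have a: "1 \<le> a" using x(1) by (simp add: a_def)
  obtain p q p' q' where h: "0 < q" "0 \<le> q'" "\<bar>p * q' - p' * q\<bar> = 1"
    "\<alpha> * (of_int q * x + of_int q') = of_int p * x + of_int p'"
    using Suc unfolding x_def by blast
  have "\<alpha> * (of_int q * (x * y) + of_int q' * y) = of_int p * (x * y) + of_int p' * y"
    using arg_cong[OF h(4), of "\<lambda>t. t * y"] by (simp add: algebra_simps)
  moreover have "x * y = of_int a * y + 1"
    by (subst x(2)) (use y in \<open>simp add: field_simps\<close>)
  ultimately have "\<alpha> * (of_int (q * a + q') * y + of_int q) = of_int (p * a + p') * y + of_int p"
    by (simp add: algebra_simps)
  moreover have "0 < q * a + q'" using h a by (simp add: add_pos_nonneg)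
  moreover have "\<bar>(p * a + p') * q - p * (q * a + q')\<bar> = 1"
    using h(3) by (simp add: algebra_simps abs_minus_commute)
  ultimately show ?case
    using h(1) unfolding y_def by (meson less_imp_le)
qed

text \<open>With \<open>x\<close> the complete quotient, the determinant gives
  \<open>\<bar>q \<alpha> - p\<bar> = 1 / (q x + q')\<close>, hence
  \<open>q \<bar>q \<alpha> - p\<bar> \<le> 1 / x\<close>. Coprimality also comes from the
  determinant.\<close>

lemma good_approximation_of_large_partial_quotient:
  assumes "\<alpha> \<notin> \<rat>" "0 < K" "K < of_int (partial_quotient \<alpha> (Suc n))"
  shows "\<exists>(q::nat) (p::int). 0 < q \<and> coprime p (int q) \<and> real q * \<bar>real q * \<alpha> - of_int p\<bar> < 1 / K"
proof -
  define x where "x = complete_quotient \<alpha> (Suc n)"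
  obtain p q p' q' :: int where h: "0 < q" "0 \<le> q'" "\<bar>p * q' - p' * q\<bar> = 1"
    "\<alpha> * (of_int q * x + of_int q') = of_int p * x + of_int p'"
    using complete_quotient_moebius[OF assms(1), of n] unfolding x_def by blast
  have x: "K < x" using assms(3) unfolding partial_quotient_def x_def by linarith
  define w where "w = of_int q * x + of_int q'"
  have qx: "0 < of_int q * x" using h(1) x assms(2) by simp
  then have w: "0 < w" "of_int q * x \<le> w" unfolding w_def using h(2) by auto
  have "(of_int q * \<alpha> - of_int p) * w = of_int q * (\<alpha> * w) - of_int p * w"
    by (simp add: algebra_simps)
  also have "\<dots> = of_int (- (p * q' - p' * q))"
    unfolding w_def h(4) by (simp add: algebra_simps)
  finally have "\<bar>of_int q * \<alpha> - of_int p\<bar> * w = 1"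
    using h(3) w(1) by (metis abs_minus_cancel abs_mult abs_of_pos of_int_1 of_int_abs)
  then have eq: "\<bar>of_int q * \<alpha> - of_int p\<bar> = 1 / w"
    using w by (simp add: field_simps)
  have "of_int q * (1 / w) \<le> of_int q * (1 / (of_int q * x))"
    using h(1) qx w by (intro mult_left_mono divide_left_mono) auto
  also have "\<dots> = 1 / x" using h(1) by simp
  also have "\<dots> < 1 / K" using x assms(2) by (simp add: frac_less2)
  finally have "of_int q * \<bar>of_int q * \<alpha> - of_int p\<bar> < 1 / K" unfolding eq .
  moreover have "coprime p q"
  proof (rule coprimeI)
    fix d assume "d dvd p" "d dvd q"
    then have "d dvd \<bar>p * q' - p' * q\<bar>" by simp
    with h(3) show "is_unit d" by simp
  qed
  ultimately show ?thesis
    using h(1) by (intro exI[of _ "nat q"] exI[of _ p]) simp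
qed

lemma irrational_multiple_neq_int:
  assumes "\<alpha> \<notin> \<rat>" "0 < q"
  shows "real q * \<alpha> - of_int p \<noteq> 0"
proof
  assume "real q * \<alpha> - of_int p = 0"
  then have "\<alpha> = of_int p / of_nat q" using assms(2) by (simp add: field_simps)
  with assms(1) show False by simp
qed

section \<open>Well approximable numbers\<close>

locale well_approximable =
  fixes \<alpha> :: real
  assumes irrational: "\<alpha> \<notin> \<rat>"
    and approximable: "0 < e \<Longrightarrow>
      \<exists>(q::nat) (p::int). 0 < q \<and> coprime p (int q) \<and> real q * \<bar>real q * \<alpha> - of_int p\<bar> < e"

lemma well_approximableI:
  assumes "\<alpha> \<notin> \<rat>" and "\<not> bdd_above (range (partial_quotient \<alpha>))"
  shows "well_approximable \<alpha>"
proof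
  fix e :: real assume e: "0 < e"
  define K where "K = 1 / e"
  \<comment> \<open>Including the quotient of index 0 in the bound forces the large quotient to have
    a positive index.\<close>
  define B where "B = max (partial_quotient \<alpha> 0) \<lceil>K\<rceil>"
  obtain n where n: "B < partial_quotient \<alpha> n"
    using assms(2) unfolding bdd_above_def by (auto simp: not_le)
  then obtain m where m: "n = Suc m" by (cases n) (auto simp: B_def)
  have "\<lceil>K\<rceil> < partial_quotient \<alpha> (Suc m)"
    using n m by (simp add: B_def)
  then have "K < of_int (partial_quotient \<alpha> (Suc m))"
    by linarith
  from good_approximation_of_large_partial_quotient[OF assms(1) _ this] e
  show "\<exists>(q::nat) (p::int). 0 < q \<and> coprime p (int q) \<and> real q * \<bar>real q * \<alpha> - of_int p\<bar> < e"
    by (simp add: K_def)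
qed (fact assms)

context well_approximable
begin

text \<open>By irrationality the finitely many positive \<open>q < K\<close> have positive
  \<open>q \<parallel>q \<alpha>\<parallel>\<close>; asking for a value below their minimum
  \<open>d\<close> excludes them.\<close>

lemma good_approximation:
  assumes "0 < e"
  obtains q :: nat and p :: int where "K \<le> q" "0 < q" "coprime p (int q)"
    "real q * \<bar>real q * \<alpha> - of_int p\<bar> < e"
proof -
  define d where "d = Min (insert e ((\<lambda>q. real q * dist_nearest_int (real q * \<alpha>)) ` {0<..<K}))"
  have "0 < real q * dist_nearest_int (real q * \<alpha>)" if "0 < q" for q
  proof -
    obtain m where "dist_nearest_int (real q * \<alpha>) = \<bar>real q * \<alpha> - of_int m\<bar>"
      by (rule dist_nearest_int_attained)
    then show ?thesis using irrational_multiple_neq_int[OF irrational that, of m] that by simp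
  qed
  then have "0 < d" using assms unfolding d_def by (subst Min_gr_iff) auto
  then obtain q p where qp: "0 < q" "coprime p (int q)" "real q * \<bar>real q * \<alpha> - of_int p\<bar> < d"
    using approximable by blast
  have "K \<le> q"
  proof (rule ccontr)
    assume "\<not> K \<le> q"
    then have "d \<le> real q * dist_nearest_int (real q * \<alpha>)"
      unfolding d_def using qp(1) by (intro Min_le) auto
    also have "\<dots> \<le> real q * \<bar>real q * \<alpha> - of_int p\<bar>"
      by (intro mult_left_mono dist_nearest_int_le) auto
    finally show False using qp(3) by simp
  qed
  moreover have "d \<le> e" unfolding d_def by (intro Min_le) auto
  ultimately show ?thesis using that qp by force
qed

end

text \<open>As \<open>p\<close> is invertible modulo \<open>q\<close>, every window of
  \<open>q\<close> integers contains an \<open>N\<close> with \<open>p N\<close> congruent to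
  \<open>l\<close>. Replacing \<alpha> by \<open>p / q\<close> in \<open>N \<alpha>\<close> then
  gives \<open>l / q\<close> modulo 1, and the last term is the error of that replacement.\<close>

lemma multiple_near_fraction:
  fixes \<alpha> :: real and p l :: int and q Q :: nat
  assumes "0 < q" "coprime p (int q)"
  obtains N :: nat and m :: int where "Q \<le> N" "N < Q + q"
    "real N * \<alpha> - of_int m = of_int l / real q + real N * (real q * \<alpha> - of_int p) / real q"
proof -
  obtain u where u: "[p * u = 1] (mod int q)"
    using cong_solve_coprime_int[OF assms(2)] by blast
  define N where "N = Q + nat ((l * u - int Q) mod int q)"
  have Nq: "N < Q + q" using assms(1) by (simp add: N_def nat_less_iff)
  have "[int N = l * u] (mod int q)"
    unfolding N_def using assms(1) by (simp add: cong_def mod_add_right_eq)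
  then have "[p * int N = p * (l * u)] (mod int q)"
    by (rule cong_scalar_left)
  also have "p * (l * u) = l * (p * u)" by simp
  also have "[l * (p * u) = l * 1] (mod int q)" using u by (rule cong_scalar_left)
  finally have "int q dvd p * int N - l" by (simp add: cong_iff_dvd_diff)
  then obtain m where "p * int N - l = int q * m" by (elim dvdE)
  then have "of_int p * real N - of_int l = real q * of_int m"
    by (metis of_int_diff of_int_mult of_int_of_nat_eq)
  then have "real N * \<alpha> - of_int m = of_int l / real q + real N * (real q * \<alpha> - of_int p) / real q"
    using assms(1) by (simp add: field_simps)
  with Nq show ?thesis by (intro that[of N m]) (auto simp: N_def)
qed


section \<open>Limits of sequences of translates\<close>

text \<open>Since \<open>Y\<close> increases, all steps after the \<open>j\<close>-th, weighted by
  \<open>Y j\<close>, are dominated by a geometric series of sum \<open>2 * C / 2 ^ j\<close>; the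
  Lipschitz bound turns this into closeness of the products.\<close>

lemma limit_of_controlled_steps:
  fixes \<gamma> :: "nat \<Rightarrow> real" and Y :: "nat \<Rightarrow> nat"
  assumes Y: "strict_mono Y"
    and step: "\<And>j. \<bar>\<gamma> (Suc j) - \<gamma> j\<bar> * real (Y j) \<le> C / 2 ^ j"
  obtains \<beta> where
    "\<And>j q. q \<le> Y j \<Longrightarrow> \<bar>inhom_product \<alpha> \<beta> q - inhom_product \<alpha> (\<gamma> j) q\<bar> \<le> 2 * C / 2 ^ j"
proof -
  define d where "d j = \<gamma> (Suc j) - \<gamma> j" for j
  have Yle: "Y j \<le> Y (i + j)" for i j
    using Y by (simp add: strict_mono_less_eq)
  have dj: "\<bar>d (i + j)\<bar> * real (Y j) \<le> C / 2 ^ j * (1 / 2) ^ i" for i j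
  proof -
    have "\<bar>d (i + j)\<bar> * real (Y j) \<le> \<bar>d (i + j)\<bar> * real (Y (i + j))"
      using Yle by (intro mult_left_mono) auto
    also have "\<dots> \<le> C / 2 ^ (i + j)" unfolding d_def by (rule step)
    finally show ?thesis by (simp add: power_add power_divide mult.commute)
  qed
  have sd: "summable (\<lambda>i. \<bar>d (i + j)\<bar>)" for j
  proof -
    \<comment> \<open>The comparison starts at index 1 because \<open>Y 0\<close> may be 0, whereas
      strict monotonicity ensures \<open>1 \<le> Y 1\<close>.\<close>
    have bound: "\<bar>d (i + Suc 0)\<bar> \<le> C / 2 * (1 / 2) ^ i" for i
    proof -
      have "1 \<le> Y (Suc 0)" using strict_mono_imp_increasing[OF Y, of "Suc 0"] by simp
      then have "\<bar>d (i + Suc 0)\<bar> * 1 \<le> \<bar>d (i + Suc 0)\<bar> * real (Y (Suc 0))"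
        by (intro mult_left_mono) auto
      also have "\<dots> \<le> C / 2 ^ Suc 0 * (1 / 2) ^ i" by (rule dj)
      finally show ?thesis by simp
    qed
    have "summable (\<lambda>i. C / 2 * (1 / 2 :: real) ^ i)"
      by (intro summable_mult summable_geometric) auto
    then have "summable (\<lambda>i. \<bar>d (i + Suc 0)\<bar>)"
      by (rule summable_comparison_test'[where N = 0]) (use bound in simp)
    then have "summable (\<lambda>i. \<bar>d i\<bar>)" by (rule summable_iff_shift[THEN iffD1])
    then show ?thesis by (rule summable_iff_shift[THEN iffD2])
  qed
  define \<beta> where "\<beta> = \<gamma> 0 + (\<Sum>i. d i)"
  have sd0: "summable d" using sd[of 0] by (auto intro: summable_rabs_cancel)
  have \<beta>: "\<beta> - \<gamma> j = (\<Sum>i. d (i + j))" for j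
  proof -
    have "(\<Sum>i<j. d i) = \<gamma> j - \<gamma> 0" unfolding d_def by (rule sum_lessThan_telescope)
    then show ?thesis
      unfolding \<beta>_def using suminf_minus_initial_segment[OF sd0, of j] by simp
  qed
  have close: "\<bar>\<beta> - \<gamma> j\<bar> * real (Y j) \<le> 2 * C / 2 ^ j" for j
  proof -
    have "\<bar>\<beta> - \<gamma> j\<bar> * real (Y j) \<le> (\<Sum>i. \<bar>d (i + j)\<bar>) * real (Y j)"
      unfolding \<beta> by (intro mult_right_mono summable_rabs sd) auto
    also have "\<dots> = (\<Sum>i. \<bar>d (i + j)\<bar> * real (Y j))"
      by (intro suminf_mult2 sd)
    also have "\<dots> \<le> (\<Sum>i. C / 2 ^ j * (1 / 2) ^ i)"
      by (intro suminf_le dj summable_mult2 sd summable_mult) (auto intro: summable_geometric)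
    also have "\<dots> = C / 2 ^ j * (1 / (1 - 1 / 2))"
      by (subst suminf_mult) (auto intro: summable_geometric simp: suminf_geometric)
    finally show ?thesis by (simp add: mult.commute)
  qed
  show ?thesis
  proof (rule that)
    fix j q assume "q \<le> Y j"
    have "\<bar>inhom_product \<alpha> \<beta> q - inhom_product \<alpha> (\<gamma> j) q\<bar> \<le> real q * \<bar>\<beta> - \<gamma> j\<bar>"
      by (rule inhom_product_lipschitz)
    also have "\<dots> \<le> real (Y j) * \<bar>\<beta> - \<gamma> j\<bar>"
      using \<open>q \<le> Y j\<close> by (intro mult_right_mono) auto
    finally show "\<bar>inhom_product \<alpha> \<beta> q - inhom_product \<alpha> (\<gamma> j) q\<bar> \<le> 2 * C / 2 ^ j"
      using close[of j] by (simp add: mult.commute)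
  qed
qed

lemma strict_mono_bracket:
  fixes Y :: "nat \<Rightarrow> nat"
  assumes "strict_mono Y" "Y J \<le> q"
  obtains j where "J \<le> j" "Y j \<le> q" "q \<le> Y (Suc j)"
proof -
  have fin: "finite {j. Y j \<le> q}"
    by (rule finite_subset[of _ "{..q}"]) (auto intro: order_trans[OF strict_mono_imp_increasing[OF assms(1)]])
  define j where "j = Max {j. Y j \<le> q}"
  have "j \<in> {j. Y j \<le> q}" unfolding j_def using assms(2) fin by (intro Max_in) auto
  moreover have "J \<le> j" unfolding j_def using assms(2) fin by (intro Max_ge) auto
  moreover have "\<not> Y (Suc j) \<le> q"
    using Max_ge[OF fin, of "Suc j"] by (auto simp flip: j_def)
  ultimately show ?thesis using that by auto
qed

text \<open>The windows between consecutive values of \<open>Y\<close> cover all large indices, and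
  the errors \<open>C / 2 ^ j\<close> tend to 0.\<close>

lemma M_plus_ge_of_brackets:
  fixes Y :: "nat \<Rightarrow> nat"
  assumes Y: "strict_mono Y" and C: "0 \<le> C"
    and lower: "\<And>j q. \<lbrakk>Y j \<le> q; q \<le> Y (Suc j)\<rbrakk> \<Longrightarrow> c - C / 2 ^ j \<le> inhom_product \<alpha> \<beta> q"
  shows "ereal c \<le> M_plus \<alpha> \<beta>"
proof (rule M_plus_geI)
  fix e :: real assume "0 < e"
  have "(\<lambda>j. C * (1 / 2) ^ j) \<longlonglongrightarrow> C * 0"
    by (intro tendsto_intros LIMSEQ_power_zero) auto
  then have "\<forall>\<^sub>F j in sequentially. C * (1 / 2) ^ j < e"
    using \<open>0 < e\<close> by (intro order_tendstoD) auto
  then obtain J where J: "\<And>j. J \<le> j \<Longrightarrow> C / 2 ^ j < e"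
    unfolding eventually_sequentially by (auto simp: power_divide)
  have "c - e \<le> inhom_product \<alpha> \<beta> q" if "Y J \<le> q" for q
  proof -
    obtain j where "J \<le> j" "Y j \<le> q" "q \<le> Y (Suc j)"
      using strict_mono_bracket[OF Y \<open>Y J \<le> q\<close>] by blast
    then show ?thesis using lower[of j q] J[of j] by linarith
  qed
  then show "\<exists>Q. \<forall>q\<ge>Q. c - e \<le> inhom_product \<alpha> \<beta> q" by blast
qed


section \<open>Lowering the products by small translations\<close>

context well_approximable
begin

text \<open>Some multiple of \<alpha> lies within \<open>3 / q\<close> of the midpoint
  \<open>x\<close> modulo 1: rounding \<open>q x\<close> down costs \<open>1 / q\<close>, and
  \<open>N \<le> 2 q\<close> bounds the other error by \<open>2 / q\<close>.\<close>

lemma multiples_dense: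
  assumes "a < b"
  obtains r :: nat and m :: int where "Q \<le> r" "a < real r * \<alpha> - of_int m" "real r * \<alpha> - of_int m < b"
proof -
  define x where "x = (a + b) / 2"
  define K where "K = max Q (nat \<lceil>6 / (b - a)\<rceil>)"
  obtain q p where q: "K \<le> q" "0 < q" "coprime p (int q)" "real q * \<bar>real q * \<alpha> - of_int p\<bar> < 1"
    using good_approximation[of 1 K] by auto
  have "6 / (b - a) \<le> real q" using q(1) unfolding K_def by linarith
  then have q6: "3 / real q \<le> (b - a) / 2" using assms q(2) by (simp add: field_simps)
  define D where "D = real q * \<alpha> - of_int p"
  obtain N m where N: "Q \<le> N" "N < Q + q"
    "real N * \<alpha> - of_int m = of_int \<lfloor>real q * x\<rfloor> / real q + real N * D / real q"
    using multiple_near_fraction[OF q(2,3)] unfolding D_def by blast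
  have "real N \<le> 2 * real q" using N(2) q(1) unfolding K_def by linarith
  then have "real N * \<bar>D\<bar> \<le> 2 * real q * \<bar>D\<bar>" by (intro mult_right_mono) auto
  also have "\<dots> < 2" using q(4) unfolding D_def by simp
  finally have ND: "\<bar>real N * D\<bar> < 2" by (simp add: abs_mult)
  have "real q * (real N * \<alpha> - of_int m - x) = of_int \<lfloor>real q * x\<rfloor> - real q * x + real N * D"
    unfolding N(3) using q(2) by (simp add: field_simps)
  then have "\<bar>real q * (real N * \<alpha> - of_int m - x)\<bar> < 3" using ND by linarith
  then have "\<bar>real N * \<alpha> - of_int m - x\<bar> < 3 / real q"
    using q(2) by (simp only: abs_mult abs_of_nat pos_less_divide_eq of_nat_0_less_iff mult.commute)
  then have "\<bar>real N * \<alpha> - of_int m - x\<bar> < (b - a) / 2" using q6 by linarith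
  then show ?thesis
    using that[of N m] N(1) unfolding x_def by (auto simp: abs_less_iff field_simps)
qed

text \<open>Translating \<open>\<gamma>\<close> by \<open>D = q \<alpha> - p\<close> with \<open>q \<bar>D\<bar>\<close> small lowers the infimum of the products by at
  most \<open>2 q \<bar>D\<bar>\<close>: for indices up to \<open>2 q\<close> by the Lipschitz bound, beyond by shifting the index by \<open>q\<close>.
  The first multiple of \<open>D\<close> bringing some product below \<open>c + e\<close> thus leaves all of them above \<open>c\<close>.\<close>

lemma lower_infimum:
  assumes c: "0 \<le> c" "c < d" and e: "0 < e" and h: "0 < h"
    and d: "\<And>q. Q \<le> q \<Longrightarrow> d \<le> inhom_product \<alpha> \<gamma> q"
  obtains \<gamma>' Q' r where "\<bar>\<gamma>' - \<gamma>\<bar> \<le> h" "\<And>q. Q \<le> q \<Longrightarrow> c \<le> inhom_product \<alpha> \<gamma>' q"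
    "Q \<le> r" "r < Q'" "inhom_product \<alpha> \<gamma>' r \<le> c + e" "\<And>q. Q' \<le> q \<Longrightarrow> d \<le> inhom_product \<alpha> \<gamma>' q"
proof -
  \<comment> \<open>The cap \<open>d - c\<close> ensures that the untranslated \<gamma> has no
    product below \<open>c + e'\<close> from \<open>Q\<close> on, so the first successful multiple
    below is a positive one.\<close>
  define e' where "e' = min e (d - c)"
  have e': "0 < e'" "e' \<le> e" "c + e' \<le> d" using c e by (auto simp: e'_def)
  \<comment> \<open>The sign of \<open>D\<close> is not yet known, so a target is prepared on each
    side of \<gamma>; the one in the direction of \<open>D\<close> is used.\<close>
  obtain r1 m1 where r1: "Q \<le> r1" "\<gamma> < real r1 * \<alpha> - of_int m1" "real r1 * \<alpha> - of_int m1 < \<gamma> + h"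
    using multiples_dense[of \<gamma> "\<gamma> + h" Q] h by auto
  obtain r2 m2 where r2: "Q \<le> r2" "\<gamma> - h < real r2 * \<alpha> - of_int m2" "real r2 * \<alpha> - of_int m2 < \<gamma>"
    using multiples_dense[of "\<gamma> - h" \<gamma> Q] h by auto
  obtain q p where q: "max Q (max r1 r2) \<le> q" "0 < q"
    "real q * \<bar>real q * \<alpha> - of_int p\<bar> < e' / 2"
    using good_approximation[of "e' / 2" "max Q (max r1 r2)"] e'(1) by (metis half_gt_zero)
  define D where "D = real q * \<alpha> - of_int p"
  have D: "D \<noteq> 0" "real q * \<bar>D\<bar> < e' / 2"
    unfolding D_def using irrational_multiple_neq_int[OF irrational q(2)] q(3) by auto
  obtain r m where r: "Q \<le> r" "r \<le> q" "\<bar>real r * \<alpha> - of_int m - \<gamma>\<bar> < h"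
    "0 \<le> (real r * \<alpha> - of_int m - \<gamma>) / D"
  proof (cases "0 < D")
    case True
    then show ?thesis using that[of r1 m1] r1 q(1) by auto
  next
    case False
    then show ?thesis using that[of r2 m2] r2 q(1) D(1) by (auto simp: zero_le_divide_iff)
  qed
  define y where "y = real r * \<alpha> - of_int m - \<gamma>"
  \<comment> \<open>After \<open>n\<close> steps the translate is within
    \<open>\<bar>D\<bar>\<close> of the target \<open>r \<alpha> - m\<close>; as
    \<open>r \<le> q\<close>, the product at \<open>r\<close> is then at most
    \<open>q \<bar>D\<bar> < e' / 2\<close>.\<close>
  define n where "n = nat \<lfloor>y / D\<rfloor>"
  have n: "real n \<le> y / D" "y / D < real n + 1"
    using r(4) unfolding n_def y_def[symmetric] by linarith+
  have yD: "\<bar>y\<bar> = y / D * \<bar>D\<bar>"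
    using r(4) D(1) unfolding y_def[symmetric] by (metis abs_mult abs_of_nonneg nonzero_divide_eq_eq)
  have nD: "real n * \<bar>D\<bar> < h"
  proof -
    have "real n * \<bar>D\<bar> \<le> \<bar>y\<bar>" unfolding yD using n(1) by (intro mult_right_mono) auto
    then show ?thesis using r(3) unfolding y_def by linarith
  qed
  define P where "P k = (\<exists>r\<ge>Q. inhom_product \<alpha> (\<gamma> + real k * D) r < c + e')" for k
  have "P n"
  proof -
    have "y - real n * D = (y / D - real n) * D" using D(1) by (simp add: field_simps)
    then have "\<bar>y - real n * D\<bar> = (y / D - real n) * \<bar>D\<bar>"
      using n(1) by (simp add: abs_mult)
    also have "\<dots> \<le> 1 * \<bar>D\<bar>" using n by (intro mult_right_mono) auto
    finally have yn: "\<bar>y - real n * D\<bar> \<le> \<bar>D\<bar>" by simp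
    have "inhom_product \<alpha> (\<gamma> + real n * D) r \<le> real r * \<bar>real r * \<alpha> - of_int m - (\<gamma> + real n * D)\<bar>"
      by (rule inhom_product_le)
    also have "\<dots> = real r * \<bar>y - real n * D\<bar>" by (simp add: y_def algebra_simps)
    also have "\<dots> \<le> real q * \<bar>D\<bar>" using r(2) yn by (intro mult_mono) auto
    also have "\<dots> < c + e'" using D(2) c(1) e'(1) by linarith
    finally show ?thesis unfolding P_def using r(1) by blast
  qed
  define n0 where "n0 = (LEAST k. P k)"
  have n0: "P n0" "n0 \<le> n" "\<And>k. k < n0 \<Longrightarrow> \<not> P k"
    unfolding n0_def using \<open>P n\<close> LeastI[of P] Least_le[of P] not_less_Least[of _ P] by blast+
  have "\<not> P 0" unfolding P_def using d e'(3) by force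
  then obtain n1 where n1: "n0 = Suc n1" using n0(1) by (cases n0) auto
  have low: "c + e' \<le> inhom_product \<alpha> (\<gamma> + real n1 * D) k" if "Q \<le> k" for k
    using n0(3)[of n1] n1 that unfolding P_def by force
  define \<gamma>' where "\<gamma>' = \<gamma> + real n0 * D"
  have \<gamma>'1: "\<gamma>' = \<gamma> + real n1 * D + real q * \<alpha> - of_int p"
    unfolding \<gamma>'_def n1 D_def by (simp add: algebra_simps)
  have low': "c \<le> inhom_product \<alpha> \<gamma>' k" if "Q \<le> k" for k
  proof (cases "k \<le> Q + q")
    case True
    have "\<bar>inhom_product \<alpha> (\<gamma> + real n1 * D) k - inhom_product \<alpha> \<gamma>' k\<bar> \<le> real k * \<bar>D\<bar>"
      using inhom_product_lipschitz[of \<alpha> "\<gamma> + real n1 * D" k \<gamma>']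
      unfolding \<gamma>'1 D_def by (simp add: algebra_simps abs_minus_commute)
    also have "\<dots> \<le> 2 * real q * \<bar>D\<bar>" using True q(1) by (intro mult_right_mono) auto
    also have "\<dots> < e'" using D(2) by simp
    finally show ?thesis using low[OF that] by linarith
  next
    case False
    have "inhom_product \<alpha> (\<gamma> + real n1 * D) (k - q) \<le> inhom_product \<alpha> \<gamma>' k"
      using inhom_product_shift[of \<alpha> "\<gamma> + real n1 * D" "k - q" q p] False unfolding \<gamma>'1 by simp
    moreover have "c + e' \<le> inhom_product \<alpha> (\<gamma> + real n1 * D) (k - q)"
      using low[of "k - q"] False by simp
    ultimately show ?thesis using e'(1) by linarith
  qed
  obtain r' where r': "Q \<le> r'" "inhom_product \<alpha> \<gamma>' r' < c + e'"
    using n0(1) unfolding P_def \<gamma>'_def by blast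
  \<comment> \<open>Translation by \<open>n0 * D\<close> moves indices by \<open>n0 * q\<close>, so
    the old bound \<open>d\<close> survives far out; the summand \<open>r' + 1\<close> places the
    threshold beyond the witness.\<close>
  have high: "d \<le> inhom_product \<alpha> \<gamma>' k" if "Q + r' + 1 + n0 * q \<le> k" for k
  proof -
    have "\<gamma>' = \<gamma> + real (n0 * q) * \<alpha> - of_int (int n0 * p)"
      unfolding \<gamma>'_def D_def by (simp add: algebra_simps)
    then have "inhom_product \<alpha> \<gamma> (k - n0 * q) \<le> inhom_product \<alpha> \<gamma>' k"
      using inhom_product_shift[of \<alpha> \<gamma> "k - n0 * q" "n0 * q" "int n0 * p"] that by simp
    moreover have "d \<le> inhom_product \<alpha> \<gamma> (k - n0 * q)"
      using that by (intro d) simp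
    ultimately show ?thesis by simp
  qed
  have "\<bar>\<gamma>' - \<gamma>\<bar> = real n0 * \<bar>D\<bar>" by (simp add: \<gamma>'_def abs_mult)
  also have "\<dots> \<le> real n * \<bar>D\<bar>" using n0(2) by (intro mult_right_mono) auto
  finally have "\<bar>\<gamma>' - \<gamma>\<bar> \<le> h" using nD by simp
  then show ?thesis
    using that[of \<gamma>' r' "Q + r' + 1 + n0 * q"] low' r' e'(2) high by fastforce
qed

section \<open>Values below an attained value\<close>

text \<open>Iterates \<open>lower_infimum\<close>. The bound \<open>d > c\<close> that persists far
  out permits the next round; the limit inherits the lower bound \<open>c\<close> up to vanishing
  errors and, in every window, a product close to \<open>c\<close>.\<close>

lemma M_plus_intermediate:
  assumes c: "0 \<le> c" "ereal c < M_plus \<alpha> \<beta>\<^sub>0"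
  shows "\<exists>\<beta>. M_plus \<alpha> \<beta> = ereal c"
proof -
  obtain d where d: "c < d" "ereal d < M_plus \<alpha> \<beta>\<^sub>0"
    using ereal_dense2[OF c(2)] by auto
  obtain Q0 where Q0: "\<And>q. Q0 \<le> q \<Longrightarrow> d < inhom_product \<alpha> \<beta>\<^sub>0 q"
    using M_plus_gtD[OF d(2)] by blast
  \<comment> \<open>A state pairs a translate with the index from which its products are at least
    \<open>d\<close>. \<open>R\<close> bounds the move and records a witness for \<open>c\<close>
    between the old and new index.\<close>
  define P where "P s = (\<forall>q\<ge>snd s. d \<le> inhom_product \<alpha> (fst s) q)" for s :: "real \<times> nat"
  define R where "R j s s' = (\<bar>fst s' - fst s\<bar> * real (snd s) \<le> 1 / 2 ^ j \<and>
      (\<forall>q\<ge>snd s. c \<le> inhom_product \<alpha> (fst s') q) \<and>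
      (\<exists>r. snd s \<le> r \<and> r < snd s' \<and> inhom_product \<alpha> (fst s') r \<le> c + 1 / 2 ^ j))"
    for j :: nat and s s' :: "real \<times> nat"
  have "\<exists>f. \<forall>j. P (f j) \<and> R j (f j) (f (Suc j))"
  proof (rule dependent_nat_choice)
    show "\<exists>s. P s" using Q0 by (intro exI[of _ "(\<beta>\<^sub>0, Q0)"]) (auto simp: P_def less_imp_le)
    fix s j assume "P s"
    then have "\<And>q. snd s \<le> q \<Longrightarrow> d \<le> inhom_product \<alpha> (fst s) q" by (simp add: P_def)
    \<comment> \<open>This is the permitted move \<open>h\<close>; adding 1 keeps the denominator
      positive when the threshold is 0.\<close>
    moreover have "0 < 1 / (2 ^ j * (real (snd s) + 1))" by (simp add: add_nonneg_pos)
    moreover have "0 < 1 / (2::real) ^ j" by simp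
    ultimately obtain \<gamma>' Q' r where s': "\<bar>\<gamma>' - fst s\<bar> \<le> 1 / (2 ^ j * (real (snd s) + 1))"
      "\<And>q. snd s \<le> q \<Longrightarrow> c \<le> inhom_product \<alpha> \<gamma>' q"
      "snd s \<le> r" "r < Q'" "inhom_product \<alpha> \<gamma>' r \<le> c + 1 / 2 ^ j"
      "\<And>q. Q' \<le> q \<Longrightarrow> d \<le> inhom_product \<alpha> \<gamma>' q"
      using lower_infimum[OF c(1) d(1)] by metis
    have "\<bar>\<gamma>' - fst s\<bar> * real (snd s) \<le> 1 / (2 ^ j * (real (snd s) + 1)) * (real (snd s) + 1)"
      using s'(1) by (intro mult_mono) auto
    also have "\<dots> = 1 / 2 ^ j" by (simp add: add_nonneg_eq_0_iff)
    finally show "\<exists>s'. P s' \<and> R j s s'"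
      using s' by (intro exI[of _ "(\<gamma>', Q')"]) (auto simp: P_def R_def)
  qed
  then obtain f where f: "\<And>j. R j (f j) (f (Suc j))" by blast
  define \<gamma> where "\<gamma> j = fst (f j)" for j
  define Y where "Y j = snd (f j)" for j
  have step: "\<bar>\<gamma> (Suc j) - \<gamma> j\<bar> * real (Y j) \<le> 1 / 2 ^ j" for j
    using f[of j] by (simp add: R_def \<gamma>_def Y_def)
  have low: "c \<le> inhom_product \<alpha> (\<gamma> (Suc j)) q" if "Y j \<le> q" for j q
    using f[of j] that by (simp add: R_def \<gamma>_def Y_def)
  have wit: "\<exists>r. Y j \<le> r \<and> r < Y (Suc j) \<and> inhom_product \<alpha> (\<gamma> (Suc j)) r \<le> c + 1 / 2 ^ j" for j
    using f[of j] by (simp add: R_def \<gamma>_def Y_def)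
  have Y: "strict_mono Y"
    unfolding strict_mono_Suc_iff using wit by (meson le_less_trans)
  obtain \<beta> where \<beta>: "\<And>j q. q \<le> Y j \<Longrightarrow>
      \<bar>inhom_product \<alpha> \<beta> q - inhom_product \<alpha> (\<gamma> j) q\<bar> \<le> 2 * 1 / 2 ^ j"
    using limit_of_controlled_steps[OF Y step] by blast
  have \<beta>': "\<bar>inhom_product \<alpha> \<beta> q - inhom_product \<alpha> (\<gamma> (Suc j)) q\<bar> \<le> 1 / 2 ^ j"
    if "q \<le> Y (Suc j)" for j q
    using \<beta>[OF that] by simp
  have "ereal c \<le> M_plus \<alpha> \<beta>"
  proof (rule M_plus_ge_of_brackets[OF Y])
    show "c - 1 / 2 ^ j \<le> inhom_product \<alpha> \<beta> q" if "Y j \<le> q" "q \<le> Y (Suc j)" for j q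
      using low[OF that(1)] \<beta>'[OF that(2)] by linarith
  qed simp
  moreover have "M_plus \<alpha> \<beta> \<le> ereal c"
  proof (rule M_plus_leI)
    fix e :: real and Q :: nat assume "0 < e"
    then obtain i where i: "(1 / 2) ^ i < e / 2"
      using real_arch_pow_inv[of "e / 2" "1 / 2"] by auto
    define j where "j = max i Q"
    have "(1 / 2 :: real) ^ j \<le> (1 / 2) ^ i" by (intro power_decreasing) (auto simp: j_def)
    then have j: "1 / 2 ^ j < e / 2" using i by (simp add: power_divide)
    obtain r where r: "Y j \<le> r" "r < Y (Suc j)" "inhom_product \<alpha> (\<gamma> (Suc j)) r \<le> c + 1 / 2 ^ j"
      using wit by blast
    have "inhom_product \<alpha> \<beta> r \<le> c + e"
      using r(3) \<beta>'[of r j] r(2) j by linarith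
    moreover have "Q \<le> r"
      using strict_mono_imp_increasing[OF Y, of j] r(1) by (simp add: j_def)
    ultimately show "\<exists>q\<ge>Q. inhom_product \<alpha> \<beta> q \<le> c + e" by blast
  qed
  ultimately show ?thesis by (intro exI[of _ \<beta>] antisym)
qed

section \<open>Finiteness and attainment of the supremum\<close>

text \<open>Makes the supremum a real number. Rounding \<open>q \<beta>\<close> down gives an
  \<open>N\<close> with \<open>N \<alpha>\<close> within about \<open>1 / q\<close> of \<beta>
  modulo 1, and \<open>N \<le> 2 q\<close> yields the constant 2.\<close>

lemma M_plus_le_2: "M_plus \<alpha> \<beta> \<le> ereal 2"
proof (rule M_plus_leI)
  fix e :: real and Q :: nat assume "0 < e"
  then obtain q p where q: "Q \<le> q" "0 < q" "coprime p (int q)"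
    "real q * \<bar>real q * \<alpha> - of_int p\<bar> < e / 4"
    using good_approximation[of "e / 4" Q] by (metis zero_less_divide_iff zero_less_numeral)
  define D where "D = real q * \<alpha> - of_int p"
  obtain N m where N: "Q \<le> N" "N < Q + q"
    "real N * \<alpha> - of_int m = of_int \<lfloor>real q * \<beta>\<rfloor> / real q + real N * D / real q"
    using multiple_near_fraction[OF q(2,3)] unfolding D_def by blast
  have N2: "real N \<le> 2 * real q" using N(2) q(1) by linarith
  then have "real N * \<bar>D\<bar> \<le> 2 * real q * \<bar>D\<bar>" by (intro mult_right_mono) auto
  also have "\<dots> < e / 2" using q(4) unfolding D_def by simp
  finally have ND: "\<bar>real N * D\<bar> < e / 2" by (simp add: abs_mult)
  have "real q * (real N * \<alpha> - of_int m - \<beta>) = of_int \<lfloor>real q * \<beta>\<rfloor> - real q * \<beta> + real N * D"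
    unfolding N(3) using q(2) by (simp add: field_simps)
  then have "\<bar>real q * (real N * \<alpha> - of_int m - \<beta>)\<bar> \<le> 1 + e / 2" using ND by linarith
  then have near: "real q * \<bar>real N * \<alpha> - of_int m - \<beta>\<bar> \<le> 1 + e / 2" by (simp add: abs_mult)
  have "inhom_product \<alpha> \<beta> N \<le> real N * \<bar>real N * \<alpha> - of_int m - \<beta>\<bar>"
    by (rule inhom_product_le)
  also have "\<dots> \<le> 2 * real q * \<bar>real N * \<alpha> - of_int m - \<beta>\<bar>"
    using N2 by (intro mult_right_mono) auto
  also have "\<dots> \<le> 2 + e" using near by simp
  finally show "\<exists>q\<ge>Q. inhom_product \<alpha> \<beta> q \<le> 2 + e" using N(1) by blast
qed

text \<open>By compactness, the residues \<open>frac (q b)\<close> of the points of any sequence agree up to small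
  errors along a suitable chain of its members, simultaneously for infinitely many good denominators.\<close>

lemma chain_with_close_residues:
  fixes b :: "nat \<Rightarrow> real"
  obtains f :: "nat \<Rightarrow> nat" where "\<And>t. t \<le> f t"
    "\<And>t K. \<exists>(q::nat) (p::int). K \<le> q \<and> 0 < q \<and> coprime p (int q) \<and>
      real q * \<bar>real q * \<alpha> - of_int p\<bar> < 1 / 2 ^ t \<and>
      \<bar>frac (real q * b (f t)) - frac (real q * b (f (Suc t)))\<bar> < 2 / 2 ^ t"
proof -
  have "\<exists>(q::nat) (p::int). i \<le> q \<and> 0 < q \<and> coprime p (int q) \<and>
      real q * \<bar>real q * \<alpha> - of_int p\<bar> < 1 / 2 ^ i" for i :: nat
    using good_approximation[of "1 / 2 ^ i" i] by (metis zero_less_divide_1_iff zero_less_numeral zero_less_power)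
  then obtain u :: "nat \<Rightarrow> nat" and v :: "nat \<Rightarrow> int" where uv:
    "\<And>i. i \<le> u i" "\<And>i. 0 < u i" "\<And>i. coprime (v i) (int (u i))"
    "\<And>i. real (u i) * \<bar>real (u i) * \<alpha> - of_int (v i)\<bar> < 1 / 2 ^ i"
    by metis
  have bound: "norm (frac (real (u i) * b j)) \<le> 1" for i j
    using frac_lt_1[of "real (u i) * b j"] by (simp add: less_imp_le)
  \<comment> \<open>A diagonal argument: one subsequence of denominators makes the residues converge
    for all \<open>j\<close> at once.\<close>
  obtain k where k: "strict_mono (k :: nat \<Rightarrow> nat)"
    "\<And>j. \<exists>l. (\<lambda>i. frac (real (u (k i)) * b j)) \<longlonglongrightarrow> l"
    using function_convergent_subsequence[of UNIV "\<lambda>i j. frac (real (u i) * b j)" 1] bound by auto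
  then obtain l where l: "\<And>j. (\<lambda>i. frac (real (u (k i)) * b j)) \<longlonglongrightarrow> l j"
    by metis
  have "l j \<in> {0..1}" for j
    using LIMSEQ_le_const[OF l[of j], of 0] LIMSEQ_le_const2[OF l[of j], of 1]
    by (auto simp: frac_lt_1 less_imp_le)
  then obtain L s where s: "strict_mono (s :: nat \<Rightarrow> nat)" "(l \<circ> s) \<longlonglongrightarrow> L"
    using compact_Icc[of 0 "1::real"] unfolding compact_def by meson
  \<comment> \<open>\<open>L\<close> is an accumulation point of the limiting residues. Members
    whose limits lie within \<open>1 / 2 ^ t\<close> of \<open>L\<close> form the chain, so
    consecutive limits differ by less than \<open>2 / 2 ^ t\<close>.\<close>
  have "\<exists>j\<ge>t. \<bar>l j - L\<bar> < 1 / 2 ^ t" for t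
  proof -
    obtain i0 where "\<And>i. i0 \<le> i \<Longrightarrow> \<bar>l (s i) - L\<bar> < 1 / 2 ^ t"
      using LIMSEQ_D[OF s(2), of "1 / 2 ^ t"] by auto
    then show ?thesis
      using strict_mono_imp_increasing[OF s(1), of "max i0 t"]
      by (meson le_trans max.cobounded1 max.cobounded2)
  qed
  then obtain f where f: "\<And>t. t \<le> f t" "\<And>t. \<bar>l (f t) - L\<bar> < 1 / 2 ^ t" by metis
  show ?thesis
  proof (rule that[OF f(1)])
    fix t K :: nat
    have "1 / 2 ^ Suc t \<le> 1 / (2::real) ^ t" by (simp add: field_simps)
    then have "\<bar>l (f t) - l (f (Suc t))\<bar> < 2 / 2 ^ t" using f(2)[of t] f(2)[of "Suc t"] by linarith
    moreover have "(\<lambda>i. \<bar>frac (real (u (k i)) * b (f t)) - frac (real (u (k i)) * b (f (Suc t)))\<bar>)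
        \<longlonglongrightarrow> \<bar>l (f t) - l (f (Suc t))\<bar>"
      by (intro tendsto_intros l)
    ultimately have "\<forall>\<^sub>F i in sequentially.
        \<bar>frac (real (u (k i)) * b (f t)) - frac (real (u (k i)) * b (f (Suc t)))\<bar> < 2 / 2 ^ t"
      by (rule order_tendstoD(2)[rotated])
    then obtain i0 where i0: "\<And>i. i0 \<le> i \<Longrightarrow>
        \<bar>frac (real (u (k i)) * b (f t)) - frac (real (u (k i)) * b (f (Suc t)))\<bar> < 2 / 2 ^ t"
      unfolding eventually_sequentially by auto
    define i where "i = max i0 (max K t)"
    have ki: "K \<le> k i" "t \<le> k i" using strict_mono_imp_increasing[OF k(1), of i] by (auto simp: i_def)
    have "(1 / 2 :: real) ^ k i \<le> (1 / 2) ^ t" using ki(2) by (intro power_decreasing) auto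
    then have "1 / 2 ^ k i \<le> 1 / (2::real) ^ t" by (simp add: power_divide)
    then have "real (u (k i)) * \<bar>real (u (k i)) * \<alpha> - of_int (v (k i))\<bar> < 1 / 2 ^ t"
      using uv(4)[of "k i"] by linarith
    moreover have "K \<le> u (k i)" using uv(1)[of "k i"] ki(1) by simp
    ultimately show "\<exists>(q::nat) (p::int). K \<le> q \<and> 0 < q \<and> coprime p (int q) \<and>
      real q * \<bar>real q * \<alpha> - of_int p\<bar> < 1 / 2 ^ t \<and>
      \<bar>frac (real q * b (f t)) - frac (real q * b (f (Suc t)))\<bar> < 2 / 2 ^ t"
      using uv(2,3) i0[of i] by (intro exI[of _ "u (k i)"] exI[of _ "v (k i)"]) (auto simp: i_def)
  qed
qed

text \<open>When the residues are close, \<open>b + T \<alpha>\<close> lies so near to some \<open>b' + (T + N) \<alpha>\<close> with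
  \<open>0 \<le> N < q\<close> that passing from one to the other hardly changes the products up to index \<open>2 q\<close>,
  while from there on the second point inherits the lower bound of \<open>b'\<close>.\<close>

lemma M_plus_ge_of_sequence:
  assumes b: "\<And>j. ereal (S - 1 / 2 ^ j) < M_plus \<alpha> (b j)"
  shows "\<exists>\<beta>. ereal S \<le> M_plus \<alpha> \<beta>"
proof -
  obtain f where f: "\<And>t. t \<le> f t"
    "\<And>t K. \<exists>(q::nat) (p::int). K \<le> q \<and> 0 < q \<and> coprime p (int q) \<and>
      real q * \<bar>real q * \<alpha> - of_int p\<bar> < 1 / 2 ^ t \<and>
      \<bar>frac (real q * b (f t)) - frac (real q * b (f (Suc t)))\<bar> < 2 / 2 ^ t"
    using chain_with_close_residues[of b] by blast
  have low: "\<exists>Q. \<forall>q\<ge>Q. S - 1 / 2 ^ j \<le> inhom_product \<alpha> (b (f j)) q" for j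
  proof -
    have "(1 / 2 :: real) ^ f j \<le> (1 / 2) ^ j" using f(1) by (intro power_decreasing) auto
    then have "1 / 2 ^ f j \<le> 1 / (2::real) ^ j" by (simp add: power_divide)
    moreover obtain Q where "\<And>q. Q \<le> q \<Longrightarrow> S - 1 / 2 ^ f j < inhom_product \<alpha> (b (f j)) q"
      using M_plus_gtD[OF b] by blast
    ultimately show ?thesis by (intro exI[of _ Q]) force
  qed
  \<comment> \<open>Besides the lower bound, a state remembers that its point is a translate of
    \<open>b (f j)\<close> by a nonnegative multiple \<open>T\<close> of \<alpha>, from which the
    next translate is built.\<close>
  define P where "P j s = ((\<forall>q\<ge>snd s. S - 1 / 2 ^ j \<le> inhom_product \<alpha> (fst s) q) \<and>
      (\<exists>(T::nat) (m::int). fst s = b (f j) + real T * \<alpha> - of_int m))"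
    for j :: nat and s :: "real \<times> nat"
  define R where "R j s s' = (snd s < snd s' \<and> \<bar>fst s' - fst s\<bar> * real (snd s') \<le> 6 / 2 ^ j)"
    for j :: nat and s s' :: "real \<times> nat"
  have "\<exists>g. \<forall>j. P j (g j) \<and> R j (g j) (g (Suc j))"
  proof (rule dependent_nat_choice)
    obtain Q where "\<forall>q\<ge>Q. S - 1 / 2 ^ 0 \<le> inhom_product \<alpha> (b (f 0)) q"
      using low by blast
    then show "\<exists>s. P 0 s"
      unfolding P_def by (intro exI[of _ "(b (f 0), Q)"] conjI exI[of _ 0]) auto
    fix s j assume Ps: "P j s"
    then obtain T :: nat and m :: int where T: "fst s = b (f j) + real T * \<alpha> - of_int m"
      unfolding P_def by blast
    obtain Q where Q: "\<And>q. Q \<le> q \<Longrightarrow> S - 1 / 2 ^ Suc j \<le> inhom_product \<alpha> (b (f (Suc j))) q"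
      using low by blast
    \<comment> \<open>Since \<open>N < q\<close> below, \<open>Q + T \<le> q\<close> makes
      \<open>k - (T + N)\<close> at least \<open>Q\<close> whenever
      \<open>2 * q \<le> k\<close>.\<close>
    obtain q p where q: "max (snd s) (Q + T) \<le> q" "0 < q" "coprime p (int q)"
      "real q * \<bar>real q * \<alpha> - of_int p\<bar> < 1 / 2 ^ j"
      "\<bar>frac (real q * b (f j)) - frac (real q * b (f (Suc j)))\<bar> < 2 / 2 ^ j"
      using f(2) by blast
    define D where "D = real q * \<alpha> - of_int p"
    \<comment> \<open>This \<open>l\<close> cancels the integer parts, so that \<open>q\<close>
      times the move is a difference of fractional parts plus \<open>N * D\<close>.\<close>
    define l where "l = \<lfloor>real q * b (f j)\<rfloor> - \<lfloor>real q * b (f (Suc j))\<rfloor>"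
    obtain N m' where N: "0 \<le> N" "N < 0 + q"
      "real N * \<alpha> - of_int m' = of_int l / real q + real N * D / real q"
      unfolding D_def by (rule multiple_near_fraction[OF q(2,3)])
    define \<gamma> where "\<gamma> = b (f (Suc j)) + real (T + N) * \<alpha> - of_int (m + m')"
    have "real N * \<bar>D\<bar> \<le> real q * \<bar>D\<bar>" using N(2) by (intro mult_right_mono) auto
    then have ND: "\<bar>real N * D\<bar> < 1 / 2 ^ j" using q(4) by (simp add: abs_mult D_def)
    have "\<gamma> - fst s = b (f (Suc j)) - b (f j) + (real N * \<alpha> - of_int m')"
      unfolding \<gamma>_def T by (simp add: algebra_simps)
    then have "(\<gamma> - fst s) * real q = real q * b (f (Suc j)) - real q * b (f j) + of_int l + real N * D"
      unfolding N(3) using q(2) by (simp add: field_simps)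
    also have "\<dots> = frac (real q * b (f (Suc j))) - frac (real q * b (f j)) + real N * D"
      by (simp add: l_def frac_def)
    \<comment> \<open>The residues contribute 2 and \<open>N * D\<close> contributes 1; the new
      threshold \<open>2 * q\<close> doubles this to 6.\<close>
    finally have "\<bar>(\<gamma> - fst s) * real q\<bar> \<le> 3 / 2 ^ j"
      using ND q(5) by (simp add: abs_le_iff abs_less_iff)
    then have "\<bar>\<gamma> - fst s\<bar> * real (2 * q) \<le> 6 / 2 ^ j" by (simp add: abs_mult)
    moreover have "snd s < 2 * q" using q(1,2) by simp
    moreover have "S - 1 / 2 ^ Suc j \<le> inhom_product \<alpha> \<gamma> k" if "2 * q \<le> k" for k
    proof -
      have "Q \<le> k - (T + N)" "T + N \<le> k" using that q(1) N(2) by auto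
      then show ?thesis
        using inhom_product_shift[of \<alpha> "b (f (Suc j))" "k - (T + N)" "T + N" "m + m'"] Q
        unfolding \<gamma>_def by (metis le_add_diff_inverse2 order_trans)
    qed
    moreover have "\<exists>(T::nat) (m::int). \<gamma> = b (f (Suc j)) + real T * \<alpha> - of_int m"
      unfolding \<gamma>_def by blast
    ultimately show "\<exists>s'. P (Suc j) s' \<and> R j s s'"
      unfolding P_def R_def by (intro exI[of _ "(\<gamma>, 2 * q)"]) simp
  qed
  then obtain g where g: "\<And>j. P j (g j)" "\<And>j. R j (g j) (g (Suc j))" by blast
  define \<gamma> where "\<gamma> j = fst (g j)" for j
  \<comment> \<open>The index is advanced by one because \<open>R\<close> weights each move by the
    new threshold; thus \<open>\<gamma> (Suc j)\<close> has its lower bound from \<open>Y j\<close>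
    on.\<close>
  define Y where "Y j = snd (g (Suc j))" for j
  have Y: "strict_mono Y"
    unfolding strict_mono_Suc_iff using g(2) by (simp add: R_def Y_def)
  have step: "\<bar>\<gamma> (Suc j) - \<gamma> j\<bar> * real (Y j) \<le> 6 / 2 ^ j" for j
    using g(2) by (simp add: R_def Y_def \<gamma>_def)
  have low': "S - 1 / 2 ^ Suc j \<le> inhom_product \<alpha> (\<gamma> (Suc j)) q" if "Y j \<le> q" for j q
    using g(1)[of "Suc j"] that by (simp add: P_def Y_def \<gamma>_def)
  obtain \<beta> where \<beta>: "\<And>j q. q \<le> Y j \<Longrightarrow>
      \<bar>inhom_product \<alpha> \<beta> q - inhom_product \<alpha> (\<gamma> j) q\<bar> \<le> 2 * 6 / 2 ^ j"
    using limit_of_controlled_steps[OF Y step] by blast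
  have "ereal S \<le> M_plus \<alpha> \<beta>"
  proof (rule M_plus_ge_of_brackets[OF Y])
    \<comment> \<open>The closeness bound at \<open>Suc j\<close> contributes
      \<open>12 / 2 ^ Suc j = 6 / 2 ^ j\<close>, and the lower bound of the translate at most
      another \<open>1 / 2 ^ j\<close>.\<close>
    show "S - 7 / 2 ^ j \<le> inhom_product \<alpha> \<beta> q" if "Y j \<le> q" "q \<le> Y (Suc j)" for j q
    proof -
      have "2 * 6 / 2 ^ Suc j = 6 / (2::real) ^ j" "1 / 2 ^ Suc j \<le> 1 / (2::real) ^ j"
        by (auto simp: field_simps)
      moreover have "6 / 2 ^ j + 1 / 2 ^ j = 7 / (2::real) ^ j" by (simp flip: add_divide_distrib)
      ultimately show ?thesis using low'[OF that(1)] \<beta>[OF that(2)] by linarith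
    qed
  qed simp
  then show ?thesis by blast
qed

lemma M_plus_sup_attained: "\<exists>\<beta>. M_plus \<alpha> \<beta> = M_plus_sup \<alpha>"
proof -
  have le: "M_plus \<alpha> \<beta> \<le> M_plus_sup \<alpha>" for \<beta>
    unfolding M_plus_sup_def by (intro SUP_upper) auto
  have "0 \<le> M_plus_sup \<alpha>" using M_plus_nonneg le order_trans by blast
  moreover have "M_plus_sup \<alpha> \<le> ereal 2"
    unfolding M_plus_sup_def by (intro SUP_least M_plus_le_2)
  ultimately obtain S where S: "M_plus_sup \<alpha> = ereal S"
    by (cases "M_plus_sup \<alpha>") auto
  have "\<exists>\<beta>. ereal (S - 1 / 2 ^ j) < M_plus \<alpha> \<beta>" for j :: nat
  proof -
    have "ereal (S - 1 / 2 ^ j) < M_plus_sup \<alpha>" unfolding S by simp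
    then show ?thesis unfolding M_plus_sup_def less_SUP_iff by blast
  qed
  then obtain b where "\<And>j. ereal (S - 1 / 2 ^ j) < M_plus \<alpha> (b j)" by metis
  then obtain \<beta> where "ereal S \<le> M_plus \<alpha> \<beta>" using M_plus_ge_of_sequence by blast
  then show ?thesis using le[of \<beta>] S by (metis antisym)
qed

end

section \<open>The set of values as a full interval\<close>

theorem theorem5p1:
  fixes \<alpha> :: real
  assumes irrational: "\<alpha> \<notin> \<rat>"
    and unbounded: "\<not> bdd_above (range (partial_quotient \<alpha>))"
  shows "{M_plus \<alpha> \<beta> | \<beta>::real. True} = {0..M_plus_sup \<alpha>}"
proof -
  interpret well_approximable \<alpha>
    using irrational unbounded by (rule well_approximableI)
  show ?thesis
  proof (intro antisym subsetI)
    fix y assume "y \<in> {M_plus \<alpha> \<beta> | \<beta>::real. True}"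
    then show "y \<in> {0..M_plus_sup \<alpha>}"
      using M_plus_nonneg by (auto simp: M_plus_sup_def intro: SUP_upper)
  next
    fix y assume y: "y \<in> {0..M_plus_sup \<alpha>}"
    show "y \<in> {M_plus \<alpha> \<beta> | \<beta>::real. True}"
    proof (cases "y = M_plus_sup \<alpha>")
      case True
      then obtain \<beta> where "M_plus \<alpha> \<beta> = y"
        using M_plus_sup_attained by auto
      then show ?thesis by blast
    next
      case False
      then have "y < M_plus_sup \<alpha>" using y by (simp add: order_less_le)
      then obtain \<beta>\<^sub>0 where lt: "y < M_plus \<alpha> \<beta>\<^sub>0"
        unfolding M_plus_sup_def less_SUP_iff by blast
      \<comment> \<open>Being nonnegative and strictly below an attained value, \<open>y\<close> is
        finite.\<close>
      then obtain c where c: "y = ereal c" "0 \<le> c"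
        using y by (cases y) auto
      then obtain \<beta> where "M_plus \<alpha> \<beta> = y"
        using M_plus_intermediate[of c \<beta>\<^sub>0] lt by auto
      then show ?thesis by blast
    qed
  qed
qed

end
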